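(* Let $T$ and $S$ be commuting mean ergodic contractions on a Banach space $X$. Then the following are equivalent: (i) $(I-T)X+(I-S)X$ is closed in $X$. (ii) $\displaystyle\frac1{n^2}\sum_{k=0}^{n-1}\sum_{j=0}^{n-1}T^kS^j$ converges in operator norm, as $n\to\infty$. (iii) $\displaystyle\frac1{nm}\sum_{k=0}^{n-1}\sum_{j=1}^{m-1}T^kS^j$ converges in operator norm, as $\min(n,m)\to\infty$.
   Context: $X$ is a real or complex Banach space. A contraction of $X$ is a linear operator $T:X\to X$ with $\|T\|\le1$. It is mean ergodic if $\frac1n\sum_{k=0}^{n-1}T^k$ converges in the strong operator topology. *)

theory Defs
  imports "HOL-Analysis.Analysis"
begin

text \<open>
  Bounded operators on \<open>X\<close> are elements of \<open>'a \<Rightarrow>\<^sub>L 'a\<close>, whose norm is the operator norm. A complex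
  Banach space is in particular a real one, and closedness, powers, averages, operator norm and
  strong operator limits do not depend on which of the two scalar fields is considered.
\<close>

definition blinfun_pow :: "('a::real_normed_vector \<Rightarrow>\<^sub>L 'a) \<Rightarrow> nat \<Rightarrow> ('a \<Rightarrow>\<^sub>L 'a)"
  where "blinfun_pow T k = ((\<lambda>U. T o\<^sub>L U) ^^ k) id_blinfun"

definition mean_ergodic :: "('a::real_normed_vector \<Rightarrow>\<^sub>L 'a) \<Rightarrow> bool"
  where "mean_ergodic T \<longleftrightarrow>
    (\<exists>P. limitin strong_operator_topology
           (\<lambda>n. (1 / real n) *\<^sub>R (\<Sum>k<n. blinfun_pow T k)) P sequentially)"

definition is_contraction :: "('a::real_normed_vector \<Rightarrow>\<^sub>L 'a) \<Rightarrow> bool"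
  where "is_contraction T \<longleftrightarrow> norm T \<le> 1"

end

theory Submission
  imports Defs
begin

text \<open>
  Write \<open>A\<^sub>n\<close>, \<open>B\<^sub>m\<close> for the Cesaro means of \<open>T\<close>, \<open>S\<close>, with strong limits \<open>P\<close>, \<open>Q\<close>, and
  \<open>M = (I - T)X + (I - S)X\<close>. If \<open>M\<close> is closed, it contains the range of \<open>I - PQ\<close>, and by the open
  mapping theorem each \<open>y \<in> M\<close> is \<open>(I - T)u + (I - S)v\<close> with \<open>\<parallel>(u, v)\<parallel> \<le> C\<parallel>y\<parallel>\<close>. Since
  \<open>A\<^sub>n(I - T)\<close> and \<open>B\<^sub>m(I - S)\<close> have norms at most \<open>2/n\<close> and \<open>2/m\<close>, this bounds
  \<open>A\<^sub>nB\<^sub>m - PQ = A\<^sub>nB\<^sub>m(I - PQ)\<close> in norm. Conversely, if \<open>A\<^sub>nB\<^sub>n \<rightarrow> L\<close> in norm, then \<open>L\<close> vanishes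
  on \<open>M\<close>; for large \<open>n\<close> the operator \<open>A\<^sub>nB\<^sub>n\<close> has norm below 1 on \<open>ker L\<close>, so \<open>I - A\<^sub>nB\<^sub>n\<close>, whose
  range lies in \<open>M\<close>, maps \<open>ker L\<close> onto itself. Hence \<open>M = ker L\<close> is closed.
\<close>

section \<open>Open mapping onto a closed range\<close>

text \<open>Successive approximation: solving approximately for the remaining residual halves it
  each time, so the corrections are dominated by a geometric series with sum
  \<open>2 * K * norm y\<close>. It serves twice: after the Baire argument below, and as a Neumann
  series on the kernel of a limit operator.\<close>

lemma exact_preimage_of_approximate:
  fixes f :: "'b::banach \<Rightarrow> 'c::real_normed_vector"
  assumes f: "bounded_linear f"
    and step: "\<And>y. y \<in> Y \<Longrightarrow>
      \<exists>x. norm x \<le> K * norm y \<and> y - f x \<in> Y \<and> norm (y - f x) \<le> norm y / 2"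
    and K: "0 \<le> K" and y: "y \<in> Y"
  shows "\<exists>x. f x = y \<and> norm x \<le> 2 * K * norm y"
proof -
  obtain g where g: "\<And>z. z \<in> Y \<Longrightarrow>
      norm (g z) \<le> K * norm z \<and> z - f (g z) \<in> Y \<and> norm (z - f (g z)) \<le> norm z / 2"
    using step by metis
  \<comment> \<open>\<open>r n\<close> is the residual left after \<open>n\<close> corrections,
    \<open>h n\<close> below is the next correction, and \<open>suminf h\<close> will be the
    preimage.\<close>
  define r where "r n = ((\<lambda>z. z - f (g z)) ^^ n) y" for n
  have r0: "r 0 = y" and rS: "r (Suc n) = r n - f (g (r n))" for n
    by (simp_all add: r_def)
  have rY: "r n \<in> Y" for n
    by (induction n) (use y g in \<open>auto simp: r0 rS\<close>)
  have rn: "norm (r n) \<le> norm y * (1/2) ^ n" for n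
  proof (induction n)
    case (Suc n)
    have "norm (r (Suc n)) \<le> norm (r n) / 2"
      using g[OF rY] by (simp add: rS)
    then show ?case using Suc by simp
  qed (simp add: r0)
  define h where "h n = g (r n)" for n
  have hn: "norm (h n) \<le> K * norm y * (1/2) ^ n" for n
  proof -
    have "norm (h n) \<le> K * norm (r n)" using g[OF rY] by (simp add: h_def)
    also have "\<dots> \<le> K * (norm y * (1/2) ^ n)" using rn K by (rule mult_left_mono)
    finally show ?thesis by (simp add: mult.assoc)
  qed
  have geo: "(\<lambda>n. K * norm y * (1/2) ^ n) sums (K * norm y * 2)"
    using sums_mult[OF geometric_sums[of "1/2 :: real"], of "K * norm y"] by simp
  have sm: "summable (\<lambda>n. norm (h n))"
    by (rule summable_comparison_test[OF _ sums_summable[OF geo]]) (use hn in auto)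
  have "norm (suminf h) \<le> (\<Sum>n. norm (h n))" using sm by (rule summable_norm)
  also have "\<dots> \<le> K * norm y * 2"
    using suminf_le[OF hn sm sums_summable[OF geo]] sums_unique[OF geo] by simp
  finally have nh: "norm (suminf h) \<le> 2 * K * norm y" by (simp add: mult_ac)
  have "(\<lambda>n. norm y * (1/2) ^ n) \<longlonglongrightarrow> norm y * 0"
    by (intro tendsto_intros) auto
  then have "r \<longlonglongrightarrow> 0"
    using rn by (intro Lim_null_comparison[of r]) auto
  \<comment> \<open>The series telescopes, since \<open>f (h n) = r n - r (Suc n)\<close>.\<close>
  then have "(\<lambda>n. f (h n)) sums (r 0 - 0)"
    using telescope_sums'[of r 0] by (simp add: rS h_def)
  moreover have "(\<lambda>n. f (h n)) sums f (suminf h)"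
    using bounded_linear.sums[OF f summable_sums[OF summable_norm_cancel[OF sm]]] .
  ultimately have "f (suminf h) = y" by (simp add: r0 sums_unique2)
  with nh show ?thesis by blast
qed

text \<open>A closed range is completely metrizable and is covered by the closures
  \<open>C n\<close> of images of balls, so by Baire some \<open>C n\<close> has interior relative
  to the range. Differences of points of \<open>C n\<close> then give approximate preimages, which
  the previous lemma makes exact.\<close>

lemma open_mapping_closed_range:
  fixes f :: "'b::banach \<Rightarrow> 'c::banach"
  assumes f: "bounded_linear f" and cl: "closed (range f)"
  obtains K where "0 \<le> K" "\<And>y. y \<in> range f \<Longrightarrow> \<exists>x. f x = y \<and> norm x \<le> K * norm y"
proof -
  interpret f: bounded_linear f by (rule f)
  define Y where "Y = range f"
  have zeroY: "0 \<in> Y" unfolding Y_def by (metis f.zero rangeI)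
  define C where "C n = closure (f ` cball 0 (real n))" for n
  have CY: "C n \<subseteq> Y" for n
    unfolding C_def Y_def by (intro closure_minimal cl) auto
  have C_approx: "\<exists>a. norm a \<le> real n \<and> dist (f a) z < d" if "z \<in> C n" "0 < d" for n z d
    using that by (fastforce simp: C_def closure_approachable)
  have UC: "\<Union> (range C) = Y"
  proof
    show "Y \<subseteq> \<Union> (range C)"
    proof
      fix y assume "y \<in> Y"
      then obtain x where x: "y = f x" by (auto simp: Y_def)
      obtain n where "norm x \<le> real n" using real_arch_simple by blast
      then have "y \<in> f ` cball 0 (real n)" using x by auto
      then show "y \<in> \<Union> (range C)" using closure_subset by (fastforce simp: C_def)
    qed
  qed (use CY in auto)
  have "\<exists>n. top_of_set Y interior_of C n \<noteq> {}"
  proof (rule ccontr)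
    assume neg: "\<not> ?thesis"
    have "completely_metrizable_space (top_of_set Y)"
      using cl unfolding Y_def
      by (metis closed_closedin completely_metrizable_space_closedin completely_metrizable_space_euclidean)
    then have "top_of_set Y interior_of \<Union> (range C) = {}"
    proof (intro Baire_category_alt disjI1)
      fix T assume "T \<in> range C"
      then show "closedin (top_of_set Y) T \<and> top_of_set Y interior_of T = {}"
        using neg CY by (auto simp: C_def intro!: closed_subset)
    qed auto
    moreover have "top_of_set Y interior_of Y = Y"
      using interior_of_topspace[of "top_of_set Y"] by simp
    ultimately show False using UC zeroY by simp
  qed
  then obtain n y0 where "y0 \<in> top_of_set Y interior_of C n" by blast
  then obtain V where V: "openin (top_of_set Y) V" "y0 \<in> V" "V \<subseteq> C n"
    by (auto simp: interior_of_def)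
  then obtain e where e: "0 < e" "ball y0 e \<inter> Y \<subseteq> V"
    by (meson openin_contains_ball)
  have y0Y: "y0 \<in> Y" using V CY by blast
  \<comment> \<open>The approximate preimage will be a difference of two vectors of norm at most
    \<open>n\<close>, divided by \<open>t = e / (2 * norm y)\<close>; this gives
    \<open>2 * n / t = K * norm y\<close>.\<close>
  define K where "K = 4 * real n / e"
  have K0: "0 \<le> K" using e by (simp add: K_def)
  have step: "\<exists>x. norm x \<le> K * norm y \<and> y - f x \<in> Y \<and> norm (y - f x) \<le> norm y / 2"
    if yY: "y \<in> Y" for y
  proof (cases "y = 0")
    case True
    then show ?thesis using zeroY by (intro exI[of _ 0]) (auto simp: f.zero)
  next
    case False
    \<comment> \<open>The rescaled vector \<open>t y\<close> is short enough that both \<open>y0\<close> and \<open>y0 + t y\<close> lie in \<open>C n\<close>.\<close>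
    define t where "t = e / (2 * norm y)"
    have t: "0 < t" using e False by (simp add: t_def)
    obtain x0 where x0: "y0 = f x0" using y0Y by (auto simp: Y_def)
    obtain x1 where x1: "y = f x1" using yY by (auto simp: Y_def)
    have "y0 + t *\<^sub>R y = f (x0 + t *\<^sub>R x1)" by (simp add: x0 x1 f.add f.scaleR)
    then have "y0 + t *\<^sub>R y \<in> Y" by (simp add: Y_def)
    moreover have "y0 + t *\<^sub>R y \<in> ball y0 e" using e False by (simp add: t_def dist_norm)
    ultimately have "y0 + t *\<^sub>R y \<in> C n" using e V by blast
    moreover have "y0 \<in> C n" using V by blast
    \<comment> \<open>With this tolerance the two approximation errors add up to
      \<open>t * norm y / 2\<close>, which after division by \<open>t\<close> is the required half
      of \<open>norm y\<close>.\<close>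
    moreover have "0 < t * norm y / 4" using t False by simp
    ultimately obtain a b where a: "norm a \<le> real n" "dist (f a) (y0 + t *\<^sub>R y) < t * norm y / 4"
      and b: "norm b \<le> real n" "dist (f b) y0 < t * norm y / 4"
      using C_approx by metis
    define x where "x = (1 / t) *\<^sub>R (a - b)"
    have "norm (a - b) \<le> 2 * real n" using a b norm_triangle_ineq4[of a b] by simp
    then have "norm x \<le> (1 / t) * (2 * real n)"
      using t by (simp add: x_def divide_right_mono)
    then have 1: "norm x \<le> K * norm y" by (simp add: K_def t_def mult_ac)
    have "t *\<^sub>R (y - f x) = (y0 + t *\<^sub>R y - f a) - (y0 - f b)"
      using t by (simp add: x_def f.scaleR f.diff algebra_simps)
    then have "t * norm (y - f x) = norm ((y0 + t *\<^sub>R y - f a) - (y0 - f b))"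
      using t by (metis abs_of_pos norm_scaleR)
    also have "\<dots> \<le> t * norm y / 4 + t * norm y / 4"
      using a(2) b(2) norm_triangle_ineq4[of "y0 + t *\<^sub>R y - f a" "y0 - f b"]
      by (simp add: dist_norm norm_minus_commute)
    finally have "t * norm (y - f x) \<le> t * (norm y / 2)" by simp
    then have 2: "norm (y - f x) \<le> norm y / 2" using t by (simp only: mult_le_cancel_left_pos)
    have "y - f x = f (x1 - x)" by (simp add: x1 f.diff)
    then have "y - f x \<in> Y" by (simp add: Y_def)
    with 1 2 show ?thesis by blast
  qed
  show ?thesis
  proof (rule that[of "2 * K"])
    show "\<exists>x. f x = y \<and> norm x \<le> 2 * K * norm y" if "y \<in> range f" for y
      using exact_preimage_of_approximate[OF f step K0] that by (auto simp: Y_def)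
  qed (use K0 in simp)
qed

section \<open>Powers and Cesaro means of a contraction\<close>

interpretation blinfun_compose: bounded_bilinear "(o\<^sub>L)"
  by (rule bounded_bilinear_blinfun_compose)

lemma blinfun_compose_assoc: "(A o\<^sub>L B) o\<^sub>L C = A o\<^sub>L (B o\<^sub>L C)"
  by (rule blinfun_eqI) simp

lemma blinfun_pow_0 [simp]: "blinfun_pow T 0 = id_blinfun"
  by (simp add: blinfun_pow_def)

lemma blinfun_pow_Suc: "blinfun_pow T (Suc k) = T o\<^sub>L blinfun_pow T k"
  by (simp add: blinfun_pow_def)

lemma blinfun_pow_commute:
  assumes "T o\<^sub>L S = S o\<^sub>L T"
  shows "blinfun_pow T k o\<^sub>L S = S o\<^sub>L blinfun_pow T k"
proof (induction k)
  case (Suc k)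
  then show ?case using assms
    by (metis blinfun_pow_Suc blinfun_compose_assoc)
qed (auto intro: blinfun_eqI)

lemma norm_blinfun_pow_le_1:
  assumes "norm T \<le> 1"
  shows "norm (blinfun_pow T k) \<le> 1"
proof (induction k)
  case (Suc k)
  have "norm (blinfun_pow T (Suc k)) \<le> norm T * norm (blinfun_pow T k)"
    unfolding blinfun_pow_Suc by (rule norm_blinfun_compose)
  also have "\<dots> \<le> 1" using assms Suc by (simp add: mult_le_one)
  finally show ?case .
qed (simp add: norm_blinfun_id_le)

text \<open>Since \<open>1 / 0 = 0\<close>, the mean for \<open>n = 0\<close> is the zero operator;
  this is why facts about fixed vectors and about \<open>x - cesaro T n x\<close> assume
  \<open>0 < n\<close>.\<close>

definition cesaro :: "('a::real_normed_vector \<Rightarrow>\<^sub>L 'a) \<Rightarrow> nat \<Rightarrow> ('a \<Rightarrow>\<^sub>L 'a)"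
  where "cesaro T n = (1 / real n) *\<^sub>R (\<Sum>k<n. blinfun_pow T k)"

lemma norm_cesaro_le_1:
  assumes "norm T \<le> 1"
  shows "norm (cesaro T n) \<le> 1"
proof (cases "n = 0")
  case False
  have "norm (\<Sum>k<n. blinfun_pow T k) \<le> real n"
    using sum_norm_le[of "{..<n}" "blinfun_pow T" "\<lambda>_. 1"] norm_blinfun_pow_le_1[OF assms] by simp
  then show ?thesis using False by (simp add: cesaro_def)
qed (simp add: cesaro_def)

lemma cesaro_commute:
  assumes "T o\<^sub>L S = S o\<^sub>L T"
  shows "cesaro T n o\<^sub>L S = S o\<^sub>L cesaro T n"
  unfolding cesaro_def
  by (simp add: blinfun_compose.scaleR_left blinfun_compose.scaleR_right blinfun_compose.sum_left
      blinfun_compose.sum_right blinfun_pow_commute[OF assms])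

lemma cesaro_commute_cesaro:
  assumes "T o\<^sub>L S = S o\<^sub>L T"
  shows "cesaro T n o\<^sub>L cesaro S m = cesaro S m o\<^sub>L cesaro T n"
  by (intro cesaro_commute) (metis assms cesaro_commute)

text \<open>The sum telescopes to \<open>I - T^n\<close>, whose norm is at most 2.\<close>

lemma norm_cesaro_defect_le:
  assumes "norm T \<le> 1"
  shows "norm (cesaro T n o\<^sub>L (id_blinfun - T)) \<le> 2 / real n"
proof -
  have "blinfun_pow T k o\<^sub>L (id_blinfun - T) = blinfun_pow T k - blinfun_pow T (Suc k)" for k
    using blinfun_pow_commute[of T T k]
    by (simp add: blinfun_compose.diff_right blinfun_pow_Suc) (auto intro: blinfun_eqI)
  then have "cesaro T n o\<^sub>L (id_blinfun - T) = (1 / real n) *\<^sub>R (id_blinfun - blinfun_pow T n)"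
    by (simp add: cesaro_def blinfun_compose.scaleR_left blinfun_compose.sum_left
        sum_lessThan_telescope')
  moreover have "norm (id_blinfun - blinfun_pow T n) \<le> 2"
    using norm_triangle_ineq4[of id_blinfun "blinfun_pow T n"] norm_blinfun_pow_le_1[OF assms, of n]
      norm_blinfun_id_le[where 'a='a] by simp
  ultimately show ?thesis by (simp add: divide_right_mono)
qed

text \<open>Each \<open>x - T^k x\<close> is a telescoping sum of vectors
  \<open>(I - T) (T^i x)\<close>, and \<open>x - cesaro T n x\<close> is the average of these
  differences.\<close>

lemma diff_cesaro_in_range:
  assumes "0 < n"
  shows "x - cesaro T n x \<in> range (blinfun_apply (id_blinfun - T))" (is "_ \<in> ?R")
proof -
  have sub: "subspace ?R"
    by (intro linear_subspace_image bounded_linear.linear blinfun.bounded_linear_right) simp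
  have pow: "x - blinfun_pow T k x \<in> ?R" for k
  proof (induction k)
    case 0
    show ?case using subspace_0[OF sub] by simp
  next
    case (Suc k)
    have "blinfun_pow T k x - blinfun_pow T (Suc k) x = (id_blinfun - T) (blinfun_pow T k x)"
      by (simp add: blinfun_pow_Suc blinfun.diff_left)
    then have "blinfun_pow T k x - blinfun_pow T (Suc k) x \<in> ?R" by simp
    from subspace_add[OF sub Suc this] show ?case by simp
  qed
  have "x - cesaro T n x = (1 / real n) *\<^sub>R (\<Sum>k<n. x - blinfun_pow T k x)"
    using assms
    by (simp add: cesaro_def blinfun.scaleR_left blinfun.sum_left sum_subtractf scaleR_diff_right
        scaleR_sum_right sum_constant_scaleR)
  then show ?thesis
    using subspace_scale[OF sub subspace_sum[OF sub pow]] by simp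
qed

lemma cesaro_fixed:
  fixes T :: "'a::real_normed_vector \<Rightarrow>\<^sub>L 'a"
  assumes "0 < n" and "T x = x"
  shows "cesaro T n x = x"
proof -
  have "blinfun_pow T k x = x" for k
    by (induction k) (simp_all add: blinfun_pow_Suc assms)
  then show ?thesis using assms
    by (simp add: cesaro_def blinfun.scaleR_left blinfun.sum_left sum_constant_scaleR)
qed

text \<open>The limit consists of fixed vectors because \<open>(I - T) (cesaro T n x)\<close> tends
  to 0, and \<open>x - P x\<close> is a limit of the vectors \<open>x - cesaro T n x\<close>, which
  lie in the range of \<open>I - T\<close> from \<open>n = 1\<close> on.\<close>

lemma mean_ergodic_limit:
  fixes T :: "'a::real_normed_vector \<Rightarrow>\<^sub>L 'a"
  assumes "norm T \<le> 1" and "mean_ergodic T"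
  obtains P where "\<And>x. (\<lambda>n. cesaro T n x) \<longlonglongrightarrow> blinfun_apply P x"
    and "\<And>x. T (P x) = P x"
    and "\<And>x. x - P x \<in> closure (range (blinfun_apply (id_blinfun - T)))"
proof -
  obtain P where "limitin strong_operator_topology (cesaro T) P sequentially"
    using assms(2) by (auto simp: mean_ergodic_def cesaro_def[abs_def])
  then have lim: "(\<lambda>n. cesaro T n x) \<longlonglongrightarrow> P x" for x
    using continuous_map_limit[OF strong_operator_topology_continuous_evaluation, of "cesaro T" P sequentially x]
    by (simp add: o_def)
  show ?thesis
  proof (rule that[OF lim])
    fix x
    have "(\<lambda>n. (id_blinfun - T) (cesaro T n x)) \<longlonglongrightarrow> 0"
    proof (rule Lim_null_comparison)
      show "\<forall>\<^sub>F n in sequentially. norm ((id_blinfun - T) (cesaro T n x)) \<le> 2 / real n * norm x"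
      proof (intro always_eventually allI)
        fix n
        have "(id_blinfun - T) o\<^sub>L cesaro T n = cesaro T n o\<^sub>L (id_blinfun - T)"
          by (rule cesaro_commute[symmetric])
             (simp add: blinfun_compose.diff_left blinfun_compose.diff_right blinfun_eqI)
        then have "(id_blinfun - T) (cesaro T n x) = (cesaro T n o\<^sub>L (id_blinfun - T)) x"
          by (metis blinfun_apply_blinfun_compose)
        also have "norm \<dots> \<le> norm (cesaro T n o\<^sub>L (id_blinfun - T)) * norm x"
          by (rule norm_blinfun)
        also have "\<dots> \<le> 2 / real n * norm x"
          by (intro mult_right_mono norm_cesaro_defect_le assms) simp
        finally show "norm ((id_blinfun - T) (cesaro T n x)) \<le> 2 / real n * norm x" .
      qed
      show "(\<lambda>n. 2 / real n * norm x) \<longlonglongrightarrow> 0"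
        by (intro tendsto_mult_left_zero lim_const_over_n)
    qed
    moreover have "(\<lambda>n. (id_blinfun - T) (cesaro T n x)) \<longlonglongrightarrow> (id_blinfun - T) (P x)"
      by (intro tendsto_intros lim)
    ultimately have "(id_blinfun - T) (P x) = 0" using LIMSEQ_unique by blast
    then show "T (P x) = P x" by (simp add: blinfun.diff_left)
    have "(\<lambda>n. x - cesaro T n x) \<longlonglongrightarrow> x - P x"
      by (intro tendsto_intros lim)
    then show "x - P x \<in> closure (range (blinfun_apply (id_blinfun - T)))"
      by (rule Lim_in_closed_set[OF closed_closure, rotated 2])
         (auto intro!: eventually_sequentiallyI[of 1] subsetD[OF closure_subset] diff_cesaro_in_range)
  qed
qed

section \<open>The sum of the ranges of \<open>I - T\<close> and \<open>I - S\<close>\<close>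

text \<open>Writing the sum of the two ranges as the range of one bounded operator on the product
  space makes the open mapping lemma applicable to it.\<close>

abbreviation defect_sum ::
    "('a::real_normed_vector \<Rightarrow>\<^sub>L 'a) \<Rightarrow> ('a \<Rightarrow>\<^sub>L 'a) \<Rightarrow> 'a \<times> 'a \<Rightarrow> 'a"
  where "defect_sum T S \<equiv> \<lambda>(u, v). (id_blinfun - T) u + (id_blinfun - S) v"

lemma bounded_linear_defect_sum: "bounded_linear (defect_sum T S)"
  unfolding case_prod_beta
  by (intro bounded_linear_add bounded_linear_compose[OF blinfun.bounded_linear_right]
      bounded_linear_fst bounded_linear_snd)

lemma defect_sum_range_left: "range (blinfun_apply (id_blinfun - T)) \<subseteq> range (defect_sum T S)"
  by (auto intro!: image_eqI[of _ _ "(_, 0)"])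

lemma defect_sum_range_right: "range (blinfun_apply (id_blinfun - S)) \<subseteq> range (defect_sum T S)"
  by (auto intro!: image_eqI[of _ _ "(0, _)"])

lemma subspace_range_defect_sum: "subspace (range (defect_sum T S))"
  by (intro linear_subspace_image bounded_linear.linear bounded_linear_defect_sum) simp

text \<open>On each summand the mean of the matching operator gives the decay, while the other mean
  is a contraction; commutativity lets the matching mean act first.\<close>

lemma norm_cesaro_cesaro_defect_sum_le:
  assumes T: "norm T \<le> 1" and S: "norm S \<le> 1" and comm: "T o\<^sub>L S = S o\<^sub>L T"
  shows "norm ((cesaro T n o\<^sub>L cesaro S m) (defect_sum T S (u, v)))
    \<le> (2 / real n + 2 / real m) * norm (u, v)"
proof -
  \<comment> \<open>Here \<open>R\<close> is \<open>T\<close> or \<open>S\<close>, \<open>w\<close>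
    the matching component of the pair, and \<open>U\<close> the mean of the other operator.\<close>
  have *: "norm (U (cesaro R k ((id_blinfun - R) w))) \<le> 2 / real k * norm (u, v)"
    if "norm U \<le> 1" "norm R \<le> 1" "norm w \<le> norm (u, v)" for U R :: "'a \<Rightarrow>\<^sub>L 'a" and k w
  proof -
    have "norm (U (cesaro R k ((id_blinfun - R) w)))
        \<le> norm U * norm ((cesaro R k o\<^sub>L (id_blinfun - R)) w)"
      using norm_blinfun[of U] by simp
    also have "\<dots> \<le> 1 * norm ((cesaro R k o\<^sub>L (id_blinfun - R)) w)"
      by (intro mult_right_mono that) simp
    also have "\<dots> \<le> norm (cesaro R k o\<^sub>L (id_blinfun - R)) * norm w"
      using norm_blinfun[of "cesaro R k o\<^sub>L (id_blinfun - R)" w] by simp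
    also have "\<dots> \<le> 2 / real k * norm (u, v)"
      by (intro mult_mono norm_cesaro_defect_le that) auto
    finally show ?thesis .
  qed
  have "cesaro T n (cesaro S m x) = cesaro S m (cesaro T n x)" for x
    using cesaro_commute_cesaro[OF comm, of n m] by (metis blinfun_apply_blinfun_compose)
  then have "(cesaro T n o\<^sub>L cesaro S m) (defect_sum T S (u, v)) =
      cesaro S m (cesaro T n ((id_blinfun - T) u)) + cesaro T n (cesaro S m ((id_blinfun - S) v))"
    by (simp add: blinfun.add_right)
  also have "norm \<dots> \<le> 2 / real n * norm (u, v) + 2 / real m * norm (u, v)"
    by (intro norm_triangle_mono * norm_cesaro_le_1 T S)
       (use norm_fst_le[of u v] norm_snd_le[of v u] in auto)
  finally show ?thesis by (simp add: algebra_simps)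
qed

section \<open>Closed range versus norm convergence of the products of means\<close>

lemma closed_range_imp_cesaro_bound:
  fixes T S :: "'a::banach \<Rightarrow>\<^sub>L 'a"
  assumes T: "norm T \<le> 1" and S: "norm S \<le> 1" and comm: "T o\<^sub>L S = S o\<^sub>L T"
    and meT: "mean_ergodic T" and meS: "mean_ergodic S"
    and cl: "closed (range (defect_sum T S))"
  obtains L K where "\<And>n m. 0 < n \<Longrightarrow> 0 < m \<Longrightarrow>
    norm ((cesaro T n o\<^sub>L cesaro S m) - L) \<le> K * (2 / real n + 2 / real m)"
proof -
  let ?M = "range (defect_sum T S)"
  obtain P where P: "\<And>x. (\<lambda>n. cesaro T n x) \<longlonglongrightarrow> blinfun_apply P x"
    "\<And>x. T (P x) = P x" "\<And>x. x - P x \<in> closure (range (blinfun_apply (id_blinfun - T)))"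
    using mean_ergodic_limit[OF T meT] by blast
  obtain Q where Q: "\<And>x. (\<lambda>n. cesaro S n x) \<longlonglongrightarrow> blinfun_apply Q x"
    "\<And>x. S (Q x) = Q x" "\<And>x. x - Q x \<in> closure (range (blinfun_apply (id_blinfun - S)))"
    using mean_ergodic_limit[OF S meS] by blast
  \<comment> \<open>\<open>P\<close> inherits commutation with \<open>S\<close> from the means of
    \<open>T\<close>; hence \<open>S P Q = P S Q = P Q\<close>, so the vectors \<open>L x\<close>
    are fixed by both operators.\<close>
  have SP: "S (P x) = P (S x)" for x
  proof -
    have "cesaro T n (S x) = S (cesaro T n x)" for n
      using cesaro_commute[OF comm, of n] by (metis blinfun_apply_blinfun_compose)
    then have "(\<lambda>n. S (cesaro T n x)) \<longlonglongrightarrow> P (S x)" using P(1)[of "S x"] by simp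
    moreover have "(\<lambda>n. S (cesaro T n x)) \<longlonglongrightarrow> S (P x)" by (intro tendsto_intros P(1))
    ultimately show ?thesis using LIMSEQ_unique by blast
  qed
  define L where "L = P o\<^sub>L Q"
  have fixL: "T (L x) = L x" "S (L x) = L x" for x
    by (simp_all add: L_def P(2) SP Q(2))
  have inM: "x - L x \<in> ?M" for x
  proof -
    have "x - Q x \<in> ?M"
      using Q(3) closure_minimal[OF defect_sum_range_right cl] by blast
    moreover have "Q x - P (Q x) \<in> ?M"
      using P(3) closure_minimal[OF defect_sum_range_left cl] by blast
    ultimately have "(x - Q x) + (Q x - P (Q x)) \<in> ?M"
      using subspace_add[OF subspace_range_defect_sum] by blast
    then show ?thesis by (simp add: L_def)
  qed
  obtain C where C: "0 \<le> C"
    "\<And>y. y \<in> ?M \<Longrightarrow> \<exists>w. defect_sum T S w = y \<and> norm w \<le> C * norm y"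
    using open_mapping_closed_range[OF bounded_linear_defect_sum cl] by metis
  \<comment> \<open>\<open>C\<close> bounds the preimage of \<open>x - L x\<close>, and
    \<open>1 + norm L\<close> bounds \<open>x - L x\<close> in terms of \<open>x\<close>.\<close>
  define K where "K = C * (1 + norm L)"
  have K0: "0 \<le> K" using C(1) by (simp add: K_def)
  show ?thesis
  proof (rule that[of L K])
    fix n m :: nat assume nm: "0 < n" "0 < m"
    show "norm ((cesaro T n o\<^sub>L cesaro S m) - L) \<le> K * (2 / real n + 2 / real m)"
    proof (rule norm_blinfun_bound)
      fix x
      let ?e = "2 / real n + 2 / real m"
      obtain u v where uv: "defect_sum T S (u, v) = x - L x" "norm (u, v) \<le> C * norm (x - L x)"
        using C(2)[OF inM, of x] by (metis surj_pair)
      \<comment> \<open>Because the means fix \<open>L x\<close>, the difference to be estimated is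
        the product of means applied to \<open>x - L x\<close>, a vector of
        \<open>?M\<close>.\<close>
      have "(cesaro T n o\<^sub>L cesaro S m) (L x) = L x"
        using nm by (simp add: cesaro_fixed fixL)
      then have "((cesaro T n o\<^sub>L cesaro S m) - L) x = (cesaro T n o\<^sub>L cesaro S m) (x - L x)"
        by (simp only: blinfun.diff_left blinfun.diff_right)
      also have "\<dots> = (cesaro T n o\<^sub>L cesaro S m) (defect_sum T S (u, v))" by (simp only: uv)
      also have "norm \<dots> \<le> ?e * norm (u, v)"
        by (rule norm_cesaro_cesaro_defect_sum_le[OF T S comm])
      also have "norm (u, v) \<le> C * ((1 + norm L) * norm x)"
      proof (rule order_trans[OF uv(2)], rule mult_left_mono[OF _ C(1)])
        show "norm (x - L x) \<le> (1 + norm L) * norm x"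
          using norm_triangle_ineq4[of x "L x"] norm_blinfun[of L x] by (simp add: algebra_simps)
      qed
      then have "?e * norm (u, v) \<le> ?e * (C * ((1 + norm L) * norm x))"
        by (rule mult_left_mono) simp
      finally show "norm (((cesaro T n o\<^sub>L cesaro S m) - L) x) \<le> K * ?e * norm x"
        by (simp add: K_def mult_ac)
    qed (use K0 in simp)
  qed
qed

lemma cesaro_convergent_imp_closed_range:
  fixes T S :: "'a::banach \<Rightarrow>\<^sub>L 'a"
  assumes T: "norm T \<le> 1" and S: "norm S \<le> 1" and comm: "T o\<^sub>L S = S o\<^sub>L T"
    and lim: "(\<lambda>n. cesaro T n o\<^sub>L cesaro S n) \<longlonglongrightarrow> L"
  shows "closed (range (defect_sum T S))"
proof -
  let ?M = "range (defect_sum T S)"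
  have limx: "(\<lambda>n. (cesaro T n o\<^sub>L cesaro S n) x) \<longlonglongrightarrow> L x" for x
    by (intro tendsto_intros lim)
  have M0: "L y = 0" if yM: "y \<in> ?M" for y
  proof -
    obtain u v where y: "y = defect_sum T S (u, v)" using yM by auto
    have "(\<lambda>n. (2 / real n + 2 / real n) * norm (u, v)) \<longlonglongrightarrow> (0 + 0) * norm (u, v)"
      by (intro tendsto_intros lim_const_over_n)
    then have "(\<lambda>n. (2 / real n + 2 / real n) * norm (u, v)) \<longlonglongrightarrow> 0"
      by simp
    then have "(\<lambda>n. (cesaro T n o\<^sub>L cesaro S n) y) \<longlonglongrightarrow> 0"
      unfolding y
      by (rule Lim_null_comparison[rotated])
         (intro always_eventually allI norm_cesaro_cesaro_defect_sum_le T S comm)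
    then show ?thesis using limx LIMSEQ_unique by blast
  qed
  obtain N where N: "\<And>n. n \<ge> N \<Longrightarrow> norm ((cesaro T n o\<^sub>L cesaro S n) - L) < 1/2"
    using LIMSEQ_D[OF lim, of "1/2"] by auto
  \<comment> \<open>The successor ensures a positive index, as needed for
    \<open>diff_cesaro_in_range\<close>.\<close>
  define n where "n = Suc N"
  have n: "0 < n" "norm ((cesaro T n o\<^sub>L cesaro S n) - L) < 1/2"
    using N[of n] by (simp_all add: n_def)
  define U where "U = cesaro T n o\<^sub>L cesaro S n"
  have U: "x - U x \<in> ?M" for x
  proof -
    have "x - cesaro S n x \<in> ?M"
      using diff_cesaro_in_range[OF n(1)] defect_sum_range_right by blast
    moreover have "cesaro S n x - cesaro T n (cesaro S n x) \<in> ?M"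
      using diff_cesaro_in_range[OF n(1)] defect_sum_range_left by blast
    ultimately have "(x - cesaro S n x) + (cesaro S n x - cesaro T n (cesaro S n x)) \<in> ?M"
      using subspace_add[OF subspace_range_defect_sum] by blast
    then show ?thesis by (simp add: U_def)
  qed
  have "{x. L x = 0} \<subseteq> ?M"
  proof
    fix y assume y: "y \<in> {x. L x = 0}"
    \<comment> \<open>A Neumann series for \<open>I - U\<close> on the kernel of \<open>L\<close>:
      the approximate preimage of \<open>z\<close> is \<open>z\<close> itself, with residual
      \<open>U z\<close>. The residual stays in the kernel because \<open>z - U z\<close> lies in
      \<open>?M\<close>, where \<open>L\<close> vanishes, and it is halved because \<open>U\<close>
      agrees with \<open>U - L\<close> on the kernel.\<close>
    have "\<exists>x. (id_blinfun - U) x = y \<and> norm x \<le> 2 * 1 * norm y"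
    proof (rule exact_preimage_of_approximate[OF blinfun.bounded_linear_right _ _ y])
      fix z assume z: "z \<in> {x. L x = 0}"
      have eq: "z - (id_blinfun - U) z = U z" by (simp add: blinfun.diff_left)
      have "L (z - U z) = 0" by (rule M0[OF U])
      then have LU: "L (U z) = 0" using z by (simp add: blinfun.diff_right)
      have "U z = (U - L) z" using z by (simp add: blinfun.diff_left)
      then have "norm (U z) \<le> norm (U - L) * norm z" by (metis norm_blinfun)
      also have "\<dots> \<le> 1/2 * norm z" using n(2) by (intro mult_right_mono) (auto simp: U_def)
      finally have "norm (U z) \<le> norm z / 2" by simp
      with LU eq show "\<exists>x. norm x \<le> 1 * norm z \<and> z - (id_blinfun - U) x \<in> {x. L x = 0} \<and>
          norm (z - (id_blinfun - U) x) \<le> norm z / 2"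
        by (intro exI[of _ z]) simp
    qed simp
    then obtain x where "y = x - U x" by (auto simp: blinfun.diff_left)
    then show "y \<in> ?M" using U by simp
  qed
  with M0 have "?M = {x. L x = 0}" by blast
  moreover have "closed {x. L x = 0}"
    by (intro closed_Collect_eq continuous_intros)
  ultimately show ?thesis by simp
qed

section \<open>Double averages and limits in two indices\<close>

lemma cesaro_compose_eq:
  "cesaro T n o\<^sub>L cesaro S m = (1 / (real n * real m)) *\<^sub>R
    (\<Sum>k=0..<n. \<Sum>j=0..<m. blinfun_pow T k o\<^sub>L blinfun_pow S j)"
proof -
  have "(\<Sum>k<n. blinfun_pow T k) o\<^sub>L (\<Sum>j<m. blinfun_pow S j)
      = (\<Sum>k<n. \<Sum>j<m. blinfun_pow T k o\<^sub>L blinfun_pow S j)"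
    unfolding blinfun_compose.sum_left unfolding blinfun_compose.sum_right ..
  then show ?thesis
    by (simp add: cesaro_def blinfun_compose.scaleR_left blinfun_compose.scaleR_right
        atLeast0LessThan mult.commute)
qed

text \<open>The omitted terms with \<open>j = 0\<close> are the powers of \<open>T\<close> alone,
  and they contribute \<open>cesaro T n\<close> divided by \<open>m\<close>.\<close>

lemma truncated_cesaro_compose_eq:
  assumes "0 < m"
  shows "(1 / (real n * real m)) *\<^sub>R
      (\<Sum>k=0..<n. \<Sum>j=1..<m. blinfun_pow T k o\<^sub>L blinfun_pow S j)
    = (cesaro T n o\<^sub>L cesaro S m) - (1 / real m) *\<^sub>R cesaro T n"
proof -
  have "(\<Sum>j=0..<m. blinfun_pow T k o\<^sub>L blinfun_pow S j)
      = blinfun_pow T k + (\<Sum>j=1..<m. blinfun_pow T k o\<^sub>L blinfun_pow S j)" for k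
    using assms by (subst sum.atLeast_Suc_lessThan) (auto intro: blinfun_eqI)
  then show ?thesis
    unfolding cesaro_compose_eq
    by (simp add: sum.distrib scaleR_add_right cesaro_def atLeast0LessThan mult.commute)
qed

abbreviation both_at_top :: "(nat \<times> nat) filter"
  where "both_at_top \<equiv> filtercomap (\<lambda>(n, m). min n m) sequentially"

lemma filterlim_fst_both_at_top: "filterlim fst sequentially both_at_top"
  and filterlim_snd_both_at_top: "filterlim snd sequentially both_at_top"
  by (rule filterlim_at_top_mono[OF filterlim_filtercomap], simp add: case_prod_beta)+

text \<open>Starting the inner sum at 1 is harmless in the limit: the discrepancy has norm at most
  \<open>1 / m\<close>.\<close>

lemma truncated_cesaro_tendsto_iff:
  assumes "norm T \<le> 1"
  shows "((\<lambda>(n, m). (1 / (real n * real m)) *\<^sub>R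
      (\<Sum>k=0..<n. \<Sum>j=1..<m. blinfun_pow T k o\<^sub>L blinfun_pow S j)) \<longlongrightarrow> L) both_at_top
    \<longleftrightarrow> ((\<lambda>(n, m). cesaro T n o\<^sub>L cesaro S m) \<longlongrightarrow> L) both_at_top"
    (is "(?f \<longlongrightarrow> L) _ \<longleftrightarrow> (?g \<longlongrightarrow> L) _")
proof (rule Lim_transform_eq, rule Lim_null_comparison)
  have "\<forall>\<^sub>F p in both_at_top. 1 \<le> snd p"
    using filterlim_snd_both_at_top by (simp add: filterlim_at_top)
  then show "\<forall>\<^sub>F p in both_at_top. norm (?f p - ?g p) \<le> 1 / real (snd p)"
  proof eventually_elim
    case (elim p)
    then have "?f p - ?g p = - ((1 / real (snd p)) *\<^sub>R cesaro T (fst p))"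
      by (simp add: case_prod_beta truncated_cesaro_compose_eq[simplified])
    then show ?case
      using norm_cesaro_le_1[OF assms, of "fst p"] by (simp add: divide_right_mono)
  qed
  show "((\<lambda>p. 1 / real (snd p)) \<longlongrightarrow> 0) both_at_top"
    by (rule filterlim_compose[OF lim_const_over_n filterlim_snd_both_at_top])
qed

theorem theorem5p3:
  fixes T S :: "'a::banach \<Rightarrow>\<^sub>L 'a"
  assumes "is_contraction T" and "is_contraction S"
    and "mean_ergodic T" and "mean_ergodic S"
    and "T o\<^sub>L S = S o\<^sub>L T"
  shows
    "(closed {a + b | a b. a \<in> range (blinfun_apply (id_blinfun - T)) \<and>
                           b \<in> range (blinfun_apply (id_blinfun - S))}
      \<longleftrightarrow>
      convergent (\<lambda>n. (1 / (real n)^2) *\<^sub>R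
        (\<Sum>k=0..<n. \<Sum>j=0..<n. blinfun_pow T k o\<^sub>L blinfun_pow S j)))
     \<and>
     (convergent (\<lambda>n. (1 / (real n)^2) *\<^sub>R
        (\<Sum>k=0..<n. \<Sum>j=0..<n. blinfun_pow T k o\<^sub>L blinfun_pow S j))
      \<longleftrightarrow>
      (\<exists>L. ((\<lambda>(n, m). (1 / (real n * real m)) *\<^sub>R
        (\<Sum>k=0..<n. \<Sum>j=1..<m. blinfun_pow T k o\<^sub>L blinfun_pow S j)) \<longlongrightarrow> L)
        (filtercomap (\<lambda>(n, m). min n m) sequentially)))"
    (is "(closed ?M \<longleftrightarrow> convergent ?D) \<and> (_ \<longleftrightarrow> ?iii)")
proof -
  have T: "norm T \<le> 1" and S: "norm S \<le> 1"
    using assms by (simp_all add: is_contraction_def)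
  have M: "?M = range (defect_sum T S)" by force
  have D: "?D = (\<lambda>n. cesaro T n o\<^sub>L cesaro S n)"
    by (simp add: cesaro_compose_eq power2_eq_square)
  let ?A = "\<lambda>(n, m). cesaro T n o\<^sub>L cesaro S m"
  have iii: "?iii \<longleftrightarrow> (\<exists>L. (?A \<longlongrightarrow> L) both_at_top)"
    by (simp only: truncated_cesaro_tendsto_iff[OF T])
  \<comment> \<open>The equivalences come from a cycle: diagonal convergence gives closedness,
    closedness gives the two-index limit, and that limit restricts to the diagonal.\<close>
  have "convergent ?D \<Longrightarrow> closed ?M"
    unfolding M D convergent_def
    using cesaro_convergent_imp_closed_range[OF T S assms(5)] by blast
  moreover have "closed ?M \<Longrightarrow> ?iii"
  proof -
    assume "closed ?M"
    then obtain L K where LK: "\<And>n m. 0 < n \<Longrightarrow> 0 < m \<Longrightarrow>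
        norm ((cesaro T n o\<^sub>L cesaro S m) - L) \<le> K * (2 / real n + 2 / real m)"
      using closed_range_imp_cesaro_bound[OF T S assms(5,3,4)] unfolding M by metis
    have "((\<lambda>p. ?A p - L) \<longlongrightarrow> 0) both_at_top"
    proof (rule Lim_null_comparison)
      \<comment> \<open>The estimate \<open>LK\<close> holds for positive indices only, which is
        eventually the case.\<close>
      have "\<forall>\<^sub>F p in both_at_top. 1 \<le> fst p" "\<forall>\<^sub>F p in both_at_top. 1 \<le> snd p"
        using filterlim_fst_both_at_top filterlim_snd_both_at_top
        by (simp_all add: filterlim_at_top)
      then show "\<forall>\<^sub>F p in both_at_top.
          norm (?A p - L) \<le> K * (2 / real (fst p) + 2 / real (snd p))"
        by eventually_elim (use LK in \<open>auto simp: case_prod_beta\<close>)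
      have "((\<lambda>p. K * (2 / real (fst p) + 2 / real (snd p))) \<longlongrightarrow> K * (0 + 0)) both_at_top"
        by (intro tendsto_intros filterlim_compose[OF lim_const_over_n filterlim_fst_both_at_top]
            filterlim_compose[OF lim_const_over_n filterlim_snd_both_at_top])
      then show "((\<lambda>p. K * (2 / real (fst p) + 2 / real (snd p))) \<longlongrightarrow> 0) both_at_top"
        by simp
    qed
    then show ?iii unfolding iii using LIM_zero_cancel by blast
  qed
  moreover have "?iii \<Longrightarrow> convergent ?D"
  proof -
    assume ?iii
    then obtain L where L: "(?A \<longlongrightarrow> L) both_at_top" unfolding iii ..
    have "filterlim (\<lambda>n. (n, n)) both_at_top sequentially"
      by (simp add: filterlim_filtercomap_iff o_def filterlim_ident)
    from filterlim_compose[OF L this] show ?thesis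
      unfolding D convergent_def by auto
  qed
  ultimately show ?thesis by blast
qed

end
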